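(* Let $\mathcal{M}=(\mathbb{R}^+\times\mathbb{R},\nabla)$, where $\nabla$ is a non-flat torsion-free connection with Christoffel symbols $\Gamma_{ij}{}^k=(x^1)^{-1}C_{ij}{}^k$, $C_{ij}{}^k=C_{ji}{}^k$ constant. The following conditions are equivalent: \begin{enumerate} \item $C_{12}{}^1=0$, $C_{22}{}^1=0$, and $C_{22}{}^2=0$. \item We have that \begin{enumerate} \item $\rho=(x^1)^{-2}(1+C_{11}{}^1-C_{12}{}^2)C_{12}{}^2\,dx^1\otimes dx^1$, \item $\nabla\rho=(x^1)^{-3}\bigl(-2(1+C_{11}{}^1)(1+C_{11}{}^1-C_{12}{}^2)C_{12}{}^2\bigr)dx^1\otimes dx^1\otimes dx^1$, \item $\alpha(\mathcal{M}):=\rho_{11;1}^2/\rho_{11}^3=4(1+C_{11}{}^1)^2/\{(1+C_{11}{}^1-C_{12}{}^2)C_{12}{}^2\}$. \end{enumerate} \item $\rho$ is symmetric, recurrent, and of rank $1$, and $\nabla\rho$ is symmetric. \end{enumerate}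
   Context: $\nabla_{\partial_i}\partial_j=\Gamma_{ij}{}^k\partial_k$. $R(\xi_1,\xi_2)=\nabla_{\xi_1}\nabla_{\xi_2}-\nabla_{\xi_2}\nabla_{\xi_1}-\nabla_{[\xi_1,\xi_2]}$ and $\rho(\xi_1,\xi_2)=\operatorname{Tr}\{\xi_3\mapsto R(\xi_3,\xi_1)\xi_2\}$; $\rho_{ij;k}$ are the components of $\nabla\rho$. A $k$-tensor is symmetric if it is invariant under all permutations of its arguments. A tensor $T$ is recurrent if $\nabla T=\omega\otimes T$ for some $1$-form $\omega$. *)

theory Defs
  imports "HOL-Analysis.Analysis"
begin

text \<open>
  All objects live on an open subset of \<open>\<real>\<^sup>n = real ^ 'n\<close> with its standard coordinates, so that
  every tangent space is identified with \<open>real ^ 'n\<close> and \<open>axis i 1\<close> is the coordinate vector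
  \<open>\<partial>\<^sub>i\<close>. Vector fields are functions \<open>real ^ 'n \<Rightarrow> real ^ 'n\<close>, of which only the values on the
  open set in question matter.
\<close>

primrec Ck_on :: "nat \<Rightarrow> (real ^ 'n) set \<Rightarrow> (real ^ 'n \<Rightarrow> 'b::real_normed_vector) \<Rightarrow> bool" where
  "Ck_on 0 S f \<longleftrightarrow> continuous_on S f"
| "Ck_on (Suc k) S f \<longleftrightarrow>
     f differentiable_on S \<and> (\<forall>i. Ck_on k S (\<lambda>p. frechet_derivative f (at p) (axis i 1)))"

text \<open>\<open>S\<close> is meant to be open: derivatives are taken at points of \<open>S\<close> in the ambient space.\<close>

definition smooth_on :: "(real ^ 'n) set \<Rightarrow> (real ^ 'n \<Rightarrow> 'b::real_normed_vector) \<Rightarrow> bool" where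
  "smooth_on S f \<longleftrightarrow> (\<forall>k. Ck_on k S f)"

text \<open>\<open>\<Gamma> p i j k\<close> is the Christoffel symbol \<open>\<Gamma>\<^sub>i\<^sub>j\<^sup>k\<close> at the point \<open>p\<close>.\<close>

type_synonym 'n christoffel = "real ^ 'n \<Rightarrow> 'n \<Rightarrow> 'n \<Rightarrow> 'n \<Rightarrow> real"

text \<open>The covariant derivative \<open>\<nabla>\<^sub>X Y\<close> of the connection with Christoffel symbols \<open>\<Gamma>\<close>.\<close>

definition nabla ::
  "'n::finite christoffel \<Rightarrow> (real ^ 'n \<Rightarrow> real ^ 'n) \<Rightarrow> (real ^ 'n \<Rightarrow> real ^ 'n) \<Rightarrow> real ^ 'n \<Rightarrow> real ^ 'n"
  where
  "nabla \<Gamma> X Y p =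
     frechet_derivative Y (at p) (X p) + (\<chi> k. \<Sum>i\<in>UNIV. \<Sum>j\<in>UNIV. \<Gamma> p i j k * X p $ i * Y p $ j)"

definition lie_bracket ::
  "(real ^ 'n \<Rightarrow> real ^ 'n) \<Rightarrow> (real ^ 'n \<Rightarrow> real ^ 'n) \<Rightarrow> real ^ 'n \<Rightarrow> real ^ 'n" where
  "lie_bracket X Y p = frechet_derivative Y (at p) (X p) - frechet_derivative X (at p) (Y p)"

definition torsion_free_on :: "(real ^ 'n) set \<Rightarrow> 'n::finite christoffel \<Rightarrow> bool" where
  "torsion_free_on M \<Gamma> \<longleftrightarrow>
     (\<forall>X Y. smooth_on M X \<longrightarrow> smooth_on M Y \<longrightarrow>
        (\<forall>p\<in>M. nabla \<Gamma> X Y p - nabla \<Gamma> Y X p = lie_bracket X Y p))"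

definition curv_op ::
  "'n::finite christoffel \<Rightarrow> (real ^ 'n \<Rightarrow> real ^ 'n) \<Rightarrow> (real ^ 'n \<Rightarrow> real ^ 'n)
     \<Rightarrow> (real ^ 'n \<Rightarrow> real ^ 'n) \<Rightarrow> real ^ 'n \<Rightarrow> real ^ 'n" where
  "curv_op \<Gamma> X Y Z p =
     nabla \<Gamma> X (nabla \<Gamma> Y Z) p - nabla \<Gamma> Y (nabla \<Gamma> X Z) p - nabla \<Gamma> (lie_bracket X Y) Z p"

text \<open>
  The curvature is a tensor, so its value on tangent vectors \<open>u, v, w\<close> at \<open>p\<close> does not depend on
  how they are extended to vector fields; we extend by constant fields, that is, by constant
  linear combinations of the \<open>\<partial>\<^sub>i\<close>. A covariant 2-tensor is represented as
  \<open>T p u v\<close>, and its covariant derivative as \<open>(\<nabla>T) p u v w\<close>.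
\<close>

definition curv ::
  "'n::finite christoffel \<Rightarrow> real ^ 'n \<Rightarrow> real ^ 'n \<Rightarrow> real ^ 'n \<Rightarrow> real ^ 'n \<Rightarrow> real ^ 'n" where
  "curv \<Gamma> p u v w = curv_op \<Gamma> (\<lambda>_. u) (\<lambda>_. v) (\<lambda>_. w) p"

definition flat_on :: "(real ^ 'n) set \<Rightarrow> 'n::finite christoffel \<Rightarrow> bool" where
  "flat_on M \<Gamma> \<longleftrightarrow> (\<forall>p\<in>M. \<forall>u v w. curv \<Gamma> p u v w = 0)"

definition ricci :: "'n::finite christoffel \<Rightarrow> real ^ 'n \<Rightarrow> real ^ 'n \<Rightarrow> real ^ 'n \<Rightarrow> real" where
  "ricci \<Gamma> p u v = trace (matrix (\<lambda>w. curv \<Gamma> p w u v))"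

text \<open>
  \<open>(\<nabla>T)(u, v; w) = w(T(u, v)) - T(\<nabla>\<^sub>w u, v) - T(u, \<nabla>\<^sub>w v)\<close>. The last argument is the direction of
  differentiation, matching the index order of \<open>T\<^sub>i\<^sub>j\<^sub>;\<^sub>k\<close>.
\<close>

definition cov_deriv ::
  "'n::finite christoffel \<Rightarrow> (real ^ 'n \<Rightarrow> real ^ 'n \<Rightarrow> real ^ 'n \<Rightarrow> real)
     \<Rightarrow> real ^ 'n \<Rightarrow> real ^ 'n \<Rightarrow> real ^ 'n \<Rightarrow> real ^ 'n \<Rightarrow> real" where
  "cov_deriv \<Gamma> T p u v w =
     frechet_derivative (\<lambda>q. T q u v) (at p) w
       - T p (nabla \<Gamma> (\<lambda>_. w) (\<lambda>_. u) p) v - T p u (nabla \<Gamma> (\<lambda>_. w) (\<lambda>_. v) p)"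

definition symmetric2_on :: "'p set \<Rightarrow> ('p \<Rightarrow> 'v \<Rightarrow> 'v \<Rightarrow> real) \<Rightarrow> bool" where
  "symmetric2_on M T \<longleftrightarrow> (\<forall>p\<in>M. \<forall>u v. T p u v = T p v u)"

definition symmetric3_on :: "'p set \<Rightarrow> ('p \<Rightarrow> 'v \<Rightarrow> 'v \<Rightarrow> 'v \<Rightarrow> real) \<Rightarrow> bool" where
  "symmetric3_on M T \<longleftrightarrow> (\<forall>p\<in>M. \<forall>u v w.
     T p u v w = T p u w v \<and> T p u v w = T p v u w \<and> T p u v w = T p v w u \<and>
     T p u v w = T p w u v \<and> T p u v w = T p w v u)"

definition one_form_on :: "(real ^ 'n) set \<Rightarrow> (real ^ 'n \<Rightarrow> real ^ 'n \<Rightarrow> real) \<Rightarrow> bool" where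
  "one_form_on M \<omega> \<longleftrightarrow> (\<forall>p\<in>M. linear (\<omega> p)) \<and> (\<forall>v. smooth_on M (\<lambda>p. \<omega> p v))"

text \<open>\<open>\<nabla>T = \<omega> \<otimes> T\<close>, where the factor \<open>\<omega>\<close> takes the direction of differentiation: \<open>T\<^sub>i\<^sub>j\<^sub>;\<^sub>k = \<omega>\<^sub>k T\<^sub>i\<^sub>j\<close>.\<close>

definition recurrent_on ::
  "(real ^ 'n) set \<Rightarrow> 'n::finite christoffel \<Rightarrow> (real ^ 'n \<Rightarrow> real ^ 'n \<Rightarrow> real ^ 'n \<Rightarrow> real) \<Rightarrow> bool" where
  "recurrent_on M \<Gamma> T \<longleftrightarrow>
     (\<exists>\<omega>. one_form_on M \<omega> \<and> (\<forall>p\<in>M. \<forall>u v w. cov_deriv \<Gamma> T p u v w = \<omega> p w * T p u v))"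

definition has_rank_on ::
  "(real ^ 'n) set \<Rightarrow> (real ^ 'n \<Rightarrow> real ^ 'n \<Rightarrow> real ^ 'n \<Rightarrow> real) \<Rightarrow> nat \<Rightarrow> bool" where
  "has_rank_on M T r \<longleftrightarrow> (\<forall>p\<in>M. rank (\<chi> i j. T p (axis i 1) (axis j 1)) = r)"

definition half_plane :: "(real ^ 2) set" where
  "half_plane = {p. 0 < p $ 1}"

text \<open>\<open>\<Gamma>\<^sub>i\<^sub>j\<^sup>k = (x\<^sup>1)\<^sup>-\<^sup>1 C\<^sub>i\<^sub>j\<^sup>k\<close>, where \<open>C i j k\<close> stands for \<open>C\<^sub>i\<^sub>j\<^sup>k\<close>.\<close>

definition type_B :: "(2 \<Rightarrow> 2 \<Rightarrow> 2 \<Rightarrow> real) \<Rightarrow> 2 christoffel" where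
  "type_B C p i j k = inverse (p $ 1) * C i j k"

definition alpha_inv :: "2 christoffel \<Rightarrow> real ^ 2 \<Rightarrow> real" where
  "alpha_inv \<Gamma> p =
     (cov_deriv \<Gamma> (ricci \<Gamma>) p (axis 1 1) (axis 1 1) (axis 1 1))\<^sup>2 / (ricci \<Gamma> p (axis 1 1) (axis 1 1)) ^ 3"

text \<open>
  The operator \<open>nabla \<Gamma>\<close> is indeed a connection with Christoffel symbols \<open>\<Gamma>\<close>, and it is
  torsion-free if \<open>\<Gamma>\<close> is symmetric in its lower indices.
\<close>

lemma nabla_add_left:
  assumes "Y differentiable (at p)"
  shows "nabla \<Gamma> (\<lambda>q. X q + X' q) Y p = nabla \<Gamma> X Y p + nabla \<Gamma> X' Y p"
  using linear_add[OF linear_frechet_derivative[OF assms]]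
  by (simp add: nabla_def vec_eq_iff algebra_simps sum.distrib)

lemma nabla_scale_left:
  assumes "Y differentiable (at p)"
  shows "nabla \<Gamma> (\<lambda>q. f q *\<^sub>R X q) Y p = f p *\<^sub>R nabla \<Gamma> X Y p"
  using linear_cmul[OF linear_frechet_derivative[OF assms]]
  by (simp add: nabla_def vec_eq_iff algebra_simps sum_distrib_left)

lemma nabla_add_right:
  assumes "Y differentiable (at p)" "Y' differentiable (at p)"
  shows "nabla \<Gamma> X (\<lambda>q. Y q + Y' q) p = nabla \<Gamma> X Y p + nabla \<Gamma> X Y' p"
proof -
  have "frechet_derivative (\<lambda>q. Y q + Y' q) (at p) =
      (\<lambda>v. frechet_derivative Y (at p) v + frechet_derivative Y' (at p) v)"
    using assms unfolding frechet_derivative_works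
    by (intro frechet_derivative_at[symmetric] has_derivative_add)
  then show ?thesis
    by (simp add: nabla_def vec_eq_iff algebra_simps sum.distrib)
qed

lemma nabla_Leibniz:
  assumes "f differentiable (at p)" "Y differentiable (at p)"
  shows "nabla \<Gamma> X (\<lambda>q. f q *\<^sub>R Y q) p =
    frechet_derivative f (at p) (X p) *\<^sub>R Y p + f p *\<^sub>R nabla \<Gamma> X Y p"
proof -
  have "frechet_derivative (\<lambda>q. f q *\<^sub>R Y q) (at p) =
      (\<lambda>v. f p *\<^sub>R frechet_derivative Y (at p) v + frechet_derivative f (at p) v *\<^sub>R Y p)"
    using assms unfolding frechet_derivative_works
    by (intro frechet_derivative_at[symmetric] has_derivative_scaleR)
  then show ?thesis
    by (simp add: nabla_def vec_eq_iff algebra_simps sum_distrib_left)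
qed

lemma nabla_axis:
  "nabla \<Gamma> (\<lambda>_. axis i 1) (\<lambda>_. axis j 1) p = (\<Sum>k\<in>UNIV. \<Gamma> p i j k *\<^sub>R axis k 1)"
proof -
  have "(\<Sum>a\<in>UNIV. \<Sum>b\<in>UNIV. \<Gamma> p a b k * axis i 1 $ a * axis j 1 $ b) = \<Gamma> p i j k" for k
    by (simp add: axis_def if_distrib[of "\<lambda>x. _ * x"] if_distrib[of "\<lambda>x. x * _"] cong: if_cong)
  then show ?thesis
    by (simp add: nabla_def vec_eq_iff axis_def if_distrib[of "\<lambda>x. _ * x"] cong: if_cong)
qed

lemma torsion_free_on_if_symmetric:
  assumes "\<And>p i j k. p \<in> M \<Longrightarrow> \<Gamma> p i j k = \<Gamma> p j i k"
  shows "torsion_free_on M \<Gamma>"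
proof -
  have "(\<Sum>i\<in>UNIV. \<Sum>j\<in>UNIV. \<Gamma> p i j k * X p $ i * Y p $ j) =
      (\<Sum>i\<in>UNIV. \<Sum>j\<in>UNIV. \<Gamma> p i j k * Y p $ i * X p $ j)" if "p \<in> M" for X Y :: "real ^ 'a \<Rightarrow> real ^ 'a" and p k
    by (subst sum.swap) (simp add: assms[OF that, of _ _ k] mult.commute mult.left_commute)
  then show ?thesis
    by (simp add: torsion_free_on_def nabla_def lie_bracket_def vec_eq_iff)
qed

end

theory Submission
  imports Defs
begin

text \<open>
  The Ricci tensor is \<open>(x\<^sup>1)\<^sup>-\<^sup>2 S\<close> for a constant matrix \<open>S\<close>, and in dimension two it determines the
  curvature, so \<open>S \<noteq> 0\<close> unless the connection is flat. If \<open>S\<^sub>1\<^sub>1\<close> is the only nonzero entry, then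
  \<open>\<rho>\<^sub>1\<^sub>2\<^sub>;\<^sub>k\<close> is a multiple of \<open>C\<^sub>k\<^sub>2\<^sup>1 S\<^sub>1\<^sub>1\<close>, so its vanishing gives \<open>C\<^sub>1\<^sub>2\<^sup>1 = C\<^sub>2\<^sub>2\<^sup>1 = 0\<close>, while the symmetry of
  \<open>\<rho>\<close> says that \<open>C\<^sub>1\<^sub>2\<^sup>1 + C\<^sub>2\<^sub>2\<^sup>2 = 0\<close>. Condition (3) reduces to this case: with \<open>S = \<plusminus> \<ell> \<otimes> \<ell>\<close>, a
  symmetric \<open>\<nabla>\<rho> = \<omega> \<otimes> \<rho>\<close> has \<open>\<omega>\<close> proportional to \<open>\<ell>\<close>, and the symmetry of \<open>C\<close> then makes
  \<open>\<delta>\<^sub>k\<^sub>1 \<ell>\<^sub>j\<close> symmetric in \<open>j\<close> and \<open>k\<close>, which forces \<open>\<ell>\<^sub>2 = 0\<close>.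
\<close>

section \<open>Rank-one matrices and smoothness of powers of an inverse coordinate\<close>

lemma open_half_plane: "open half_plane"
  unfolding half_plane_def by (intro open_Collect_less continuous_intros)

lemma rank_eq_1_iff:
  fixes A :: "real ^ 2 ^ 2"
  shows "rank A = 1 \<longleftrightarrow> det A = 0 \<and> A \<noteq> 0"
  using det_eq_0_rank[of A] rank_eq_0[of A] by auto

text \<open>In a fixed direction the derivative is again a constant times a power of the inverse
  coordinate. This closed form drives the induction for smoothness.\<close>

lemma has_derivative_inverse_component_power:
  fixes p :: "real ^ 'n"
  assumes "p $ i \<noteq> 0"
  shows "((\<lambda>q. c * inverse (q $ i) ^ n) has_derivative
    (\<lambda>w. - (real n * c * inverse (p $ i) ^ Suc n * w $ i))) (at p)"
proof -
  have "((\<lambda>q. c * inverse (q $ i) ^ n) has_derivative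
      (\<lambda>w. c * (real n * inverse (p $ i) ^ (n - 1) * (- (inverse (p $ i) * w $ i * inverse (p $ i)))))) (at p)"
    using assms
    by (auto intro!: derivative_eq_intros bounded_linear_imp_has_derivative bounded_linear_vec_nth simp: ac_simps)
  moreover have "c * (real n * inverse (p $ i) ^ (n - 1) * (- (inverse (p $ i) * w $ i * inverse (p $ i))))
      = - (real n * c * inverse (p $ i) ^ Suc n * w $ i)" for w :: "real ^ 'n"
    \<comment> \<open>For \<open>n = 0\<close> the truncated exponent \<open>n - 1\<close> is
      harmless because of the factor \<open>real n\<close>.\<close>
    by (cases n) auto
  ultimately show ?thesis
    by (simp only:)
qed

lemma Ck_on_cong:
  assumes "open S" "\<And>p. p \<in> S \<Longrightarrow> f p = g p"
  shows "Ck_on k S f \<longleftrightarrow> Ck_on k S g"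
  using assms(2)
proof (induction k arbitrary: f g)
  case 0
  then show ?case
    using continuous_on_cong by force
next
  case (Suc k)
  have D: "(f has_derivative D) (at p) \<longleftrightarrow> (g has_derivative D) (at p)" if "p \<in> S" for D p
  proof
    show "(g has_derivative D) (at p)" if "(f has_derivative D) (at p)"
      using that assms(1) \<open>p \<in> S\<close> Suc.prems by (rule has_derivative_transform_within_open)
    show "(f has_derivative D) (at p)" if "(g has_derivative D) (at p)"
      using that assms(1) \<open>p \<in> S\<close> Suc.prems[symmetric] by (rule has_derivative_transform_within_open)
  qed
  \<comment> \<open>\<open>frechet_derivative\<close> is a choice among derivatives, so equivalent
    \<open>has_derivative\<close> predicates give the same choice, even where none exists.\<close>
  have "Ck_on k S (\<lambda>p. frechet_derivative f (at p) v) \<longleftrightarrow> Ck_on k S (\<lambda>p. frechet_derivative g (at p) v)" for v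
    by (rule Suc.IH) (simp add: frechet_derivative_def D)
  moreover have "f differentiable_on S \<longleftrightarrow> g differentiable_on S"
    by (simp add: differentiable_on_eq_differentiable_at[OF assms(1)] differentiable_def D)
  ultimately show ?case
    by simp
qed

lemma smooth_on_inverse_component_power:
  fixes S :: "(real ^ 'n) set"
  assumes "open S" "\<And>p. p \<in> S \<Longrightarrow> p $ i \<noteq> 0"
  shows "smooth_on S (\<lambda>p. c * inverse (p $ i) ^ n)"
proof -
  have "Ck_on k S (\<lambda>p. c * inverse (p $ i) ^ n)" for k
  proof (induction k arbitrary: c n)
    case 0
    then show ?case
      using assms(2) by (auto intro!: continuous_intros)
  next
    case (Suc k)
    have "(\<lambda>p. c * inverse (p $ i) ^ n) differentiable_on S"
      using has_derivative_inverse_component_power[OF assms(2)]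
      unfolding differentiable_on_eq_differentiable_at[OF assms(1)] differentiable_def by blast
    moreover have "Ck_on k S (\<lambda>p. frechet_derivative (\<lambda>p. c * inverse (p $ i) ^ n) (at p) v)" for v
    proof -
      have "frechet_derivative (\<lambda>p. c * inverse (p $ i) ^ n) (at p) v
          = - (real n * c * v $ i) * inverse (p $ i) ^ Suc n" if "p \<in> S" for p
        using frechet_derivative_at[OF has_derivative_inverse_component_power[OF assms(2)[OF that], of c n]]
        by (simp add: fun_eq_iff algebra_simps flip: power_Suc)
      then show ?thesis
        using Suc.IH[of "- (real n * c * v $ i)" "Suc n"] Ck_on_cong[OF assms(1)] by (metis (no_types, lifting))
    qed
    ultimately show ?case
      by simp
  qed
  then show ?thesis
    by (simp add: smooth_on_def)
qed

section \<open>Curvature, Ricci tensor and its covariant derivative for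
  \<open>type_B C\<close>\<close>

definition bilin :: "(2 \<Rightarrow> 2 \<Rightarrow> 2 \<Rightarrow> real) \<Rightarrow> real ^ 2 \<Rightarrow> real ^ 2 \<Rightarrow> real ^ 2" where
  "bilin C u v = (\<chi> k. \<Sum>i\<in>UNIV. \<Sum>j\<in>UNIV. C i j k * u $ i * v $ j)"

lemma nabla_type_B:
  "nabla (type_B C) X Y p =
     frechet_derivative Y (at p) (X p) + inverse (p $ 1) *\<^sub>R bilin C (X p) (Y p)"
  by (simp add: nabla_def type_B_def bilin_def vec_eq_iff sum_distrib_left mult.assoc)

lemma nabla_type_B_const:
  "nabla (type_B C) (\<lambda>_. u) (\<lambda>_. v) = (\<lambda>p. inverse (p $ 1) *\<^sub>R bilin C u v)"
  by (simp add: nabla_type_B fun_eq_iff)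

lemma bilin_scaleR_right: "bilin C u (c *\<^sub>R v) = c *\<^sub>R bilin C u v"
  by (simp add: bilin_def vec_eq_iff sum_distrib_left algebra_simps)

lemma bilin_0_left: "bilin C 0 v = 0"
  by (simp add: bilin_def vec_eq_iff)

lemma frechet_derivative_inverse_component_scaleR:
  fixes p :: "real ^ 'n" and z :: "'b::real_normed_vector"
  assumes "p $ i \<noteq> 0"
  shows "frechet_derivative (\<lambda>q. inverse (q $ i) *\<^sub>R z) (at p) w
    = - (inverse (p $ i) ^ 2 * w $ i) *\<^sub>R z"
proof -
  have "((\<lambda>q. inverse (q $ i)) has_derivative (\<lambda>w. - (inverse (p $ i) ^ 2 * w $ i))) (at p)"
    using has_derivative_inverse_component_power[OF assms, of 1 1] by (simp add: power2_eq_square)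
  from has_derivative_scaleR_left[OF this]
  have "((\<lambda>q. inverse (q $ i) *\<^sub>R z) has_derivative (\<lambda>w. - (inverse (p $ i) ^ 2 * w $ i) *\<^sub>R z)) (at p)" .
  from frechet_derivative_at[OF this] show ?thesis
    by (simp add: fun_eq_iff)
qed

text \<open>Constant fields commute, so no bracket term survives. The terms linear in
  \<open>bilin\<close> come from differentiating the factor \<open>inverse (p $ 1)\<close>.\<close>

lemma curv_type_B:
  assumes "p $ 1 \<noteq> 0"
  shows "curv (type_B C) p u v w = inverse (p $ 1) ^ 2 *\<^sub>R
    (v $ 1 *\<^sub>R bilin C u w - u $ 1 *\<^sub>R bilin C v w
      + bilin C u (bilin C v w) - bilin C v (bilin C u w))"
proof -
  have "lie_bracket (\<lambda>_. u) (\<lambda>_. v) = (\<lambda>_. 0)"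
    by (simp add: lie_bracket_def fun_eq_iff)
  then show ?thesis
    unfolding curv_def curv_op_def
    by (simp add: nabla_type_B_const nabla_type_B[of _ _ "\<lambda>q. inverse (q $ 1) *\<^sub>R _"]
        frechet_derivative_inverse_component_scaleR[OF assms] bilin_scaleR_right bilin_0_left
        power2_eq_square algebra_simps)
qed

text \<open>From \<open>\<rho>_ij = d_k \<Gamma>_ij^k - d_i \<Gamma>_kj^k + \<Gamma>_km^k
  \<Gamma>_ij^m - \<Gamma>_im^k \<Gamma>_kj^m\<close> with \<open>\<Gamma> = C / x1\<close>: each
  derivative contributes \<open>-1 / x1^2\<close> and is nonzero only in direction 1.\<close>

definition ricci_coeff :: "(2 \<Rightarrow> 2 \<Rightarrow> 2 \<Rightarrow> real) \<Rightarrow> 2 \<Rightarrow> 2 \<Rightarrow> real" where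
  "ricci_coeff C i j = - C i j 1 + (\<Sum>k\<in>UNIV. if i = 1 then C k j k else 0)
     + (\<Sum>k\<in>UNIV. \<Sum>m\<in>UNIV. C k m k * C i j m - C i m k * C k j m)"

lemma ricci_type_B:
  assumes "p $ 1 \<noteq> 0"
  shows "ricci (type_B C) p u v =
    (\<Sum>i\<in>UNIV. \<Sum>j\<in>UNIV. ricci_coeff C i j * u $ i * v $ j) * inverse (p $ 1) ^ 2"
  by (simp add: ricci_def trace_def matrix_def curv_type_B[OF assms] bilin_def ricci_coeff_def
      axis_def sum_2) (simp add: algebra_simps)

text \<open>Antisymmetry in \<open>u, v\<close> leaves only \<open>R(e1, e2) w\<close>. The trace
  defining \<open>\<rho>(e2, w)\<close> is its first component, and the one defining
  \<open>\<rho>(e1, w)\<close> is minus its second.\<close>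

lemma curv_type_B_eq_ricci:
  assumes "p $ 1 \<noteq> 0"
  shows "curv (type_B C) p u v w = (u $ 1 * v $ 2 - u $ 2 * v $ 1) *\<^sub>R
    vector [ricci (type_B C) p (axis 2 1) w, - ricci (type_B C) p (axis 1 1) w]"
  by (simp add: ricci_type_B[OF assms] curv_type_B[OF assms] bilin_def ricci_coeff_def
      axis_def sum_2 vec_eq_iff forall_2 vector_2) (simp add: algebra_simps)

lemma cov_deriv_ricci_type_B:
  assumes "p $ 1 \<noteq> 0"
  shows "cov_deriv (type_B C) (ricci (type_B C)) p u v w = - (inverse (p $ 1) ^ 3) *
    (\<Sum>i\<in>UNIV. \<Sum>j\<in>UNIV. ricci_coeff C i j *
      (2 * w $ 1 * u $ i * v $ j + bilin C w u $ i * v $ j + u $ i * bilin C w v $ j))"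
proof -
  let ?s = "\<Sum>i\<in>UNIV. \<Sum>j\<in>UNIV. ricci_coeff C i j * u $ i * v $ j"
  \<comment> \<open>The closed form of \<open>ricci\<close> is available only off the line
    \<open>q $ 1 = 0\<close>; openness lets it be differentiated at \<open>p\<close>.\<close>
  have op: "open {q :: real ^ 2. q $ 1 \<noteq> 0}"
    by (intro open_Collect_neq continuous_intros)
  have "((\<lambda>q. ricci (type_B C) q u v) has_derivative
      (\<lambda>w. - (real 2 * ?s * inverse (p $ 1) ^ Suc 2 * w $ 1))) (at p)"
    by (rule has_derivative_transform_within_open[OF has_derivative_inverse_component_power[OF assms] op])
      (use assms in \<open>auto simp: ricci_type_B\<close>)
  from frechet_derivative_at[OF this, symmetric] show ?thesis
    by (simp add: cov_deriv_def nabla_type_B_const ricci_type_B[OF assms] sum_2 power2_eq_square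
        power3_eq_cube) (simp add: algebra_simps)
qed

text \<open>The off-diagonal entries share their quadratic terms, so their difference is
  \<open>C 2 2 2 + C 1 2 1\<close>.\<close>

lemma ricci_coeff_symmetric_2:
  assumes "\<And>i j k. C i j k = C j i k"
  shows
    "ricci_coeff C 1 1 = C 1 2 2 * (1 + C 1 1 1 - C 1 2 2) + C 1 1 2 * (C 2 2 2 - C 1 2 1)"
    "ricci_coeff C 1 2 = C 2 2 2 + C 1 2 1 * C 1 2 2 - C 1 1 2 * C 2 2 1"
    "ricci_coeff C 2 1 = - C 1 2 1 + C 1 2 1 * C 1 2 2 - C 1 1 2 * C 2 2 1"
    "ricci_coeff C 2 2 = C 2 2 1 * (C 1 1 1 - C 1 2 2 - 1) + C 1 2 1 * (C 2 2 2 - C 1 2 1)"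
  using assms[of 2 1 1] assms[of 2 1 2]
  by (simp_all add: ricci_coeff_def sum_2 algebra_simps)

theorem lemma2p10:
  fixes C :: "2 \<Rightarrow> 2 \<Rightarrow> 2 \<Rightarrow> real"
  assumes sym: "\<And>i j k. C i j k = C j i k"
    and torsion_free: "torsion_free_on half_plane (type_B C)"
    and non_flat: "\<not> flat_on half_plane (type_B C)"
  shows
    "(C 1 2 1 = 0 \<and> C 2 2 1 = 0 \<and> C 2 2 2 = 0
      \<longleftrightarrow>
      (\<forall>p\<in>half_plane. \<forall>u v. ricci (type_B C) p u v =
          (p $ 1) powi (-2) * ((1 + C 1 1 1 - C 1 2 2) * C 1 2 2) * (u $ 1 * v $ 1)) \<and>
      (\<forall>p\<in>half_plane. \<forall>u v w. cov_deriv (type_B C) (ricci (type_B C)) p u v w =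
          (p $ 1) powi (-3) * (-2 * (1 + C 1 1 1) * (1 + C 1 1 1 - C 1 2 2) * C 1 2 2)
            * (u $ 1 * v $ 1 * w $ 1)) \<and>
      (\<forall>p\<in>half_plane. alpha_inv (type_B C) p =
          4 * (1 + C 1 1 1)\<^sup>2 / ((1 + C 1 1 1 - C 1 2 2) * C 1 2 2)))
     \<and>
     (C 1 2 1 = 0 \<and> C 2 2 1 = 0 \<and> C 2 2 2 = 0
      \<longleftrightarrow>
      symmetric2_on half_plane (ricci (type_B C)) \<and>
      recurrent_on half_plane (type_B C) (ricci (type_B C)) \<and>
      has_rank_on half_plane (ricci (type_B C)) 1 \<and>
      symmetric3_on half_plane (cov_deriv (type_B C) (ricci (type_B C))))"
    (is "(?cond \<longleftrightarrow> ?Ric \<and> ?Cov \<and> ?alpha) \<and> (_ \<longleftrightarrow> ?Sym2 \<and> ?Rec \<and> ?rank \<and> ?Sym3)")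
proof -
  define S where "S = ricci_coeff C"
  define \<rho> where "\<rho> = ricci (type_B C)"
  define D where "D = cov_deriv (type_B C) (ricci (type_B C))"
  define R where "R = (1 + C 1 1 1 - C 1 2 2) * C 1 2 2"
  note S_eq = ricci_coeff_symmetric_2[where C = C, OF sym, folded S_def]
  have C21: "C 2 1 k = C 1 2 k" for k
    using sym .
  have \<rho>: "\<rho> p u v = (S 1 1 * u $ 1 * v $ 1 + S 1 2 * u $ 1 * v $ 2
      + S 2 1 * u $ 2 * v $ 1 + S 2 2 * u $ 2 * v $ 2) * inverse (p $ 1) ^ 2"
    if "p \<in> half_plane" for p u v
    using that by (simp add: \<rho>_def S_def half_plane_def ricci_type_B sum_2)
  have D: "D p u v w = - (inverse (p $ 1) ^ 3) *
      (\<Sum>i\<in>UNIV. \<Sum>j\<in>UNIV. S i j *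
        (2 * w $ 1 * u $ i * v $ j + bilin C w u $ i * v $ j + u $ i * bilin C w v $ j))"
    if "p \<in> half_plane" for p u v w
    using that by (simp add: D_def S_def half_plane_def cov_deriv_ricci_type_B)
  have S_nonzero: "\<not> (S 1 1 = 0 \<and> S 1 2 = 0 \<and> S 2 1 = 0 \<and> S 2 2 = 0)"
  proof
    assume zero: "S 1 1 = 0 \<and> S 1 2 = 0 \<and> S 2 1 = 0 \<and> S 2 2 = 0"
    have "curv (type_B C) p u v w = 0" if "p \<in> half_plane" for p u v w
      using zero \<rho>[OF that] that
      by (simp add: curv_type_B_eq_ricci half_plane_def vec_eq_iff forall_2 vector_2 flip: \<rho>_def)
    then show False
      using non_flat by (simp add: flat_on_def)
  qed
  \<comment> \<open>All powers of \<open>x1\<close> equal 1 at this point, so evaluating there gives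
    equations between the constants alone.\<close>
  define o1 :: "real ^ 2" where "o1 = axis 1 1"
  have o1: "o1 \<in> half_plane" "o1 $ 1 = 1"
    by (simp_all add: o1_def half_plane_def axis_def)

  have normal_form: "S 1 1 = R" "S 1 2 = 0" "S 2 1 = 0" "S 2 2 = 0" if ?cond
    using that by (simp_all add: S_eq R_def)
  have Ric: "\<rho> p u v = inverse (p $ 1) ^ 2 * R * (u $ 1 * v $ 1)" if ?cond "p \<in> half_plane" for p u v
    by (simp add: \<rho>[OF that(2)] normal_form[OF that(1)])
  have Cov: "D p u v w = inverse (p $ 1) ^ 3 * (-2 * (1 + C 1 1 1) * R) * (u $ 1 * v $ 1 * w $ 1)"
    if ?cond "p \<in> half_plane" for p u v w
    using that(1)
    by (simp add: D[OF that(2)] normal_form[OF that(1)] sum_2 bilin_def C21) (simp add: algebra_simps)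

  have fwd2: "?Ric \<and> ?Cov \<and> ?alpha" if ?cond
  proof (intro conjI ballI allI)
    fix p u v w assume p: "p \<in> half_plane"
    then have pos: "p $ 1 > 0"
      by (simp add: half_plane_def)
    show "ricci (type_B C) p u v =
        (p $ 1) powi (-2) * ((1 + C 1 1 1 - C 1 2 2) * C 1 2 2) * (u $ 1 * v $ 1)"
      using Ric[OF that p] by (simp add: \<rho>_def R_def power_int_minus power_inverse)
    show "cov_deriv (type_B C) (ricci (type_B C)) p u v w =
        (p $ 1) powi (-3) * (-2 * (1 + C 1 1 1) * (1 + C 1 1 1 - C 1 2 2) * C 1 2 2)
          * (u $ 1 * v $ 1 * w $ 1)"
      using Cov[OF that p] by (simp add: D_def R_def power_int_minus power_inverse mult.assoc)
    \<comment> \<open>In the case \<open>R = 0\<close> both sides are 0, since division by zero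
      yields 0.\<close>
    have "alpha_inv (type_B C) p = 4 * (1 + C 1 1 1)\<^sup>2 / R"
      unfolding alpha_inv_def D_def[symmetric]
      unfolding \<rho>_def[symmetric] Ric[OF that p] Cov[OF that p]
      using pos by (cases "R = 0") (simp_all add: field_simps power2_eq_square power3_eq_cube)
    then show "alpha_inv (type_B C) p = 4 * (1 + C 1 1 1)\<^sup>2 / ((1 + C 1 1 1 - C 1 2 2) * C 1 2 2)"
      by (simp add: R_def)
  qed

  have bwd2: ?cond if ?Ric ?Cov
  proof -
    have "\<rho> o1 u v = R * (u $ 1 * v $ 1)" for u v
      using that(1) o1 by (simp add: \<rho>_def R_def)
    from this[of "axis 1 1" "axis 1 1"] this[of "axis 1 1" "axis 2 1"]
      this[of "axis 2 1" "axis 1 1"] this[of "axis 2 1" "axis 2 1"]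
    have S: "S 1 1 = R" "S 1 2 = 0" "S 2 1 = 0" "S 2 2 = 0"
      by (simp_all add: \<rho>[OF o1(1)] o1 axis_def)
    have "D o1 (axis 1 1) (axis 2 1) (axis k 1) = 0" for k
      using that(2) o1(1) by (simp add: D_def axis_def)
    from this[of 1] this[of 2] have "R * C 1 2 1 = 0" "R * C 2 2 1 = 0"
      by (simp_all add: D[OF o1(1)] o1 axis_def bilin_def sum_2 S)
    moreover have "R \<noteq> 0"
      using S S_nonzero by auto
    \<comment> \<open>Once \<open>C 1 2 1\<close> and \<open>C 2 2 1\<close> vanish,
      \<open>S 1 2\<close> collapses to \<open>C 2 2 2\<close>.\<close>
    ultimately show ?thesis
      using S(2) by (simp add: S_eq)
  qed

  have fwd3: "?Sym2 \<and> ?Rec \<and> ?rank \<and> ?Sym3" if ?cond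
  proof (intro conjI)
    have "R \<noteq> 0"
      using normal_form[OF that] S_nonzero by auto
    show ?Sym2
      unfolding symmetric2_on_def \<rho>_def[symmetric] by (simp add: Ric[OF that])
    show ?Sym3
      unfolding symmetric3_on_def D_def[symmetric] by (simp add: Cov[OF that])
    show ?rank
      unfolding has_rank_on_def rank_eq_1_iff \<rho>_def[symmetric]
    proof
      fix p assume p: "p \<in> half_plane"
      then have "inverse (p $ 1) ^ 2 * R \<noteq> 0"
        using \<open>R \<noteq> 0\<close> by (simp add: half_plane_def)
      then show "det (\<chi> i j. \<rho> p (axis i 1) (axis j 1)) = 0 \<and> (\<chi> i j. \<rho> p (axis i 1) (axis j 1)) \<noteq> 0"
        by (simp add: Ric[OF that p] det_2 vec_eq_iff forall_2 axis_def)
    qed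
    show ?Rec
      unfolding recurrent_on_def \<rho>_def[symmetric]
    proof (intro exI conjI ballI allI)
      \<comment> \<open>The quotient of the formulas for \<open>D\<close> and \<open>\<rho>\<close>.
        The exponent 1 is written out to match the smoothness lemma.\<close>
      let ?\<omega> = "\<lambda>(p :: real ^ 2) w :: real ^ 2. (- 2 * (1 + C 1 1 1) * w $ 1) * inverse (p $ 1) ^ 1"
      have "linear (?\<omega> p)" for p
        by (rule linearI) (simp_all add: algebra_simps)
      moreover have "smooth_on half_plane (\<lambda>p. ?\<omega> p w)" for w
        by (rule smooth_on_inverse_component_power[OF open_half_plane]) (simp add: half_plane_def)
      ultimately show "one_form_on half_plane ?\<omega>"
        by (simp add: one_form_on_def)
      show "cov_deriv (type_B C) \<rho> p u v w = ?\<omega> p w * \<rho> p u v" if p: "p \<in> half_plane" for p u v w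
        using Cov[OF \<open>?cond\<close> p, of u v w] Ric[OF \<open>?cond\<close> p, of u v]
        by (simp add: D_def \<rho>_def power2_eq_square power3_eq_cube)
    qed
  qed

  \<comment> \<open>Reducing a symmetric recurrent rank-one Ricci tensor to a multiple of
    \<open>dx1 \<otimes> dx1\<close>\<close>
  have bwd3: ?cond if ?Sym2 ?Rec ?rank ?Sym3
  proof -
    have "\<rho> o1 (axis 1 1) (axis 2 1) = \<rho> o1 (axis 2 1) (axis 1 1)"
      using \<open>?Sym2\<close> o1(1) by (simp add: symmetric2_on_def \<rho>_def)
    then have S21: "S 2 1 = S 1 2"
      by (simp add: \<rho>[OF o1(1)] o1(2) axis_def)
    then have C222: "C 2 2 2 = - C 1 2 1"
      by (simp add: S_eq)
    have "det (\<chi> i j. \<rho> o1 (axis i 1) (axis j 1)) = 0"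
      using \<open>?rank\<close> o1(1) unfolding has_rank_on_def rank_eq_1_iff \<rho>_def by blast
    then have det: "S 1 1 * S 2 2 = S 1 2 * S 1 2"
      by (simp add: det_2 \<rho>[OF o1(1)] o1(2) axis_def S21)
    obtain \<omega> where "\<And>p u v w. p \<in> half_plane \<Longrightarrow> D p u v w = \<omega> p w * \<rho> p u v"
      using \<open>?Rec\<close> unfolding recurrent_on_def D_def \<rho>_def by blast
    then obtain \<phi> where \<phi>: "D o1 u v w = \<phi> w * \<rho> o1 u v" for u v w
      using o1(1) by blast
    define f where "f k = \<phi> (axis k 1)" for k :: 2
    \<comment> \<open>Components of the recurrence equation at \<open>o1\<close>; the digits are the
      two tensor indices followed by the direction of differentiation.\<close>
    have D121: "- (2 * S 1 2 + C 1 1 1 * S 1 2 + C 1 1 2 * S 2 2 + C 1 2 1 * S 1 1 + C 1 2 2 * S 1 2) = f 1 * S 1 2"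
      and D122: "- (C 1 2 1 * S 1 2 + C 1 2 2 * S 2 2 + C 2 2 1 * S 1 1 + C 2 2 2 * S 1 2) = f 2 * S 1 2"
      and D221: "- 2 * (S 2 2 + C 1 2 1 * S 1 2 + C 1 2 2 * S 2 2) = f 1 * S 2 2"
      and D222: "- 2 * (C 2 2 1 * S 1 2 + C 2 2 2 * S 2 2) = f 2 * S 2 2"
      using \<phi>[of "axis 1 1" "axis 2 1" "axis 1 1"] \<phi>[of "axis 1 1" "axis 2 1" "axis 2 1"]
        \<phi>[of "axis 2 1" "axis 2 1" "axis 1 1"] \<phi>[of "axis 2 1" "axis 2 1" "axis 2 1"]
      by (simp_all add: D[OF o1(1)] \<rho>[OF o1(1)] o1(2) axis_def bilin_def sum_2 S21 C21 f_def algebra_simps)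
    have "D o1 (axis 1 1) (axis 2 1) (axis 2 1) = D o1 (axis 2 1) (axis 2 1) (axis 1 1)"
      using \<open>?Sym3\<close> o1(1) unfolding symmetric3_on_def D_def[symmetric] by blast
    then have f: "f 2 * S 1 2 = f 1 * S 2 2"
      by (simp add: \<phi> \<rho>[OF o1(1)] o1(2) axis_def f_def)
    \<comment> \<open>Write \<open>N\<close> for \<open>\<nabla>\<rho>\<close> at \<open>o1\<close>. Since \<open>det S = 0\<close>, the combination
      \<open>2 S\<^sub>2\<^sub>2 N\<^sub>1\<^sub>2\<^sub>2 - S\<^sub>1\<^sub>2 N\<^sub>2\<^sub>2\<^sub>2 - S\<^sub>2\<^sub>2 N\<^sub>2\<^sub>2\<^sub>1\<close> equals \<open>2 S\<^sub>2\<^sub>2\<^sup>2\<close>; by recurrence and symmetry it vanishes.\<close>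
    have "S 2 2 = 0"
      using D122 D221 D222 f det by algebra
    moreover from this have "S 1 2 = 0"
      using det by simp
    moreover from calculation have "S 1 1 \<noteq> 0"
      using S_nonzero S21 by auto
    ultimately have "C 1 2 1 = 0" "C 2 2 1 = 0"
      using D121 D122 by simp_all
    then show ?thesis
      using C222 by simp
  qed
  show ?thesis
    using fwd2 bwd2 fwd3 bwd3 by blast
qed

end
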